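(* Let $q\ge 1$ be an integer and let $K$ belong to $L^2(\Omega_{2q}^2)$. If $K=J*J$ for some $J$ in $\mathcal{B}^2(\Omega_{2q}^2)$, then $K$ is in fact a continuous kernel (as an element of $L^2(\Omega_{2q}^2)$, i.e. it coincides almost everywhere with a continuous function on $\Omega_{2q}\times\Omega_{2q}$).
   Context: $\Omega_{2q}$ is the unit sphere of $\mathbb{C}^q$, $\sigma_q$ its (rotation invariant) surface measure, and $\omega_q=2\pi^q/(q-1)!$ its total measure (so for $q=1$ it is the unit circle with arc length measure of total mass $2\pi$). A kernel on $\Omega_{2q}$ is a complex function on $\Omega_{2q}^2:=\Omega_{2q}\times\Omega_{2q}$; $L^2(\Omega_{2q}^2)=L^2(\Omega_{2q}^2,\sigma_q\times\sigma_q)$, with elements treated as functions and equality understood almost everywhere. A kernel $K$ is zonal if $K(\rho(x),\rho(y))=K(x,y)$ for all $x,y\in\Omega_{2q}$ and all unitary linear operators $\rho$ on $\mathbb{C}^q$. $\mathcal{B}^2(\Omega_{2q}^2)$ is the space of all zonal kernels in $L^2(\Omega_{2q}^2)$. The generalized convolution is $(K_1*K_2)(x,y)=\frac{1}{\omega_q}\int_{\Omega_{2q}}K_1(x,\xi)K_2(\xi,y)\,d\sigma_q(\xi)$. *)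

theory Defs
  imports "HOL-Analysis.Analysis"
begin

definition cinner :: "complex ^ 'q::finite \<Rightarrow> complex ^ 'q \<Rightarrow> complex" where
  "cinner x y = (\<Sum>i\<in>UNIV. x $ i * cnj (y $ i))"

definition unitary_op :: "(complex ^ 'q::finite \<Rightarrow> complex ^ 'q) \<Rightarrow> bool" where
  "unitary_op \<rho> \<longleftrightarrow> Vector_Spaces.linear (*s) (*s) \<rho> \<and> surj \<rho> \<and>
     (\<forall>x y. cinner (\<rho> x) (\<rho> y) = cinner x y)"

text \<open>
  The space \<open>\<complex>\<^sup>q\<close> is \<open>complex ^ 'q\<close> with \<open>q = CARD('q)\<close>, of real dimension \<open>2 * q\<close>; its
  unit sphere is \<open>sphere 0 1\<close>.  The surface measure of a Borel set \<open>A\<close> of the sphere is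
  \<open>2 * q\<close> times the Lebesgue measure of the cone \<open>{t *\<^sub>R x | 0 < t \<le> 1, x \<in> A}\<close>
  (integration in polar coordinates).
\<close>

definition surface_measure :: "(complex ^ 'q::finite) measure" where
  "surface_measure =
     scale_measure (ennreal (real (2 * CARD('q))))
       (distr (restrict_space lborel (cball 0 1 - {0})) (restrict_space borel (sphere 0 1))
         (\<lambda>x. x /\<^sub>R norm x))"

definition sphere_area :: "nat \<Rightarrow> real" where
  "sphere_area q = 2 * pi ^ q / fact (q - 1)"

lemma space_surface_measure [simp]: "space surface_measure = sphere 0 1"
  by (simp add: surface_measure_def space_restrict_space space_scale_measure)

lemma sets_surface_measure [simp]:
  "sets surface_measure = sets (restrict_space borel (sphere 0 1))"
  by (simp add: surface_measure_def)

lemma emeasure_surface_measure: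
  assumes "A \<in> sets borel" "A \<subseteq> sphere 0 1"
  shows "emeasure (surface_measure :: (complex ^ 'q::finite) measure) A =
    ennreal (real (2 * CARD('q))) *
      emeasure lborel {x. 0 < norm x \<and> norm x \<le> 1 \<and> x /\<^sub>R norm x \<in> A}"
proof -
  let ?S = "cball 0 1 - {0} :: (complex ^ 'q) set"
  have m: "(\<lambda>x. x /\<^sub>R norm x) \<in> restrict_space lborel ?S \<rightarrow>\<^sub>M restrict_space borel (sphere 0 1)"
  proof (rule measurable_restrict_space2)
    show "(\<lambda>x. x /\<^sub>R norm x) \<in> space (restrict_space lborel ?S) \<rightarrow> sphere 0 1"
      by (auto simp: space_restrict_space)
    show "(\<lambda>x. x /\<^sub>R norm x) \<in> restrict_space lborel ?S \<rightarrow>\<^sub>M borel"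
      by (rule measurable_restrict_space1) simp
  qed
  have A: "A \<in> sets (restrict_space borel (sphere 0 1))"
    using assms by (auto simp: sets_restrict_space)
  have eq: "(\<lambda>x. x /\<^sub>R norm x) -` A \<inter> ?S = {x. 0 < norm x \<and> norm x \<le> 1 \<and> x /\<^sub>R norm x \<in> A}"
    by auto
  have sub: "{x. 0 < norm x \<and> norm x \<le> 1 \<and> x /\<^sub>R norm x \<in> A} \<subseteq> ?S"
    by auto
  show ?thesis
    unfolding surface_measure_def
    by (simp add: emeasure_distr[OF m A] space_restrict_space
        emeasure_restrict_space[OF _ sub] eq del: zero_less_norm_iff)
qed

lemma surface_measure_sphere:
  "emeasure (surface_measure :: (complex ^ 'q::finite) measure) (sphere 0 1) =
     ennreal (sphere_area CARD('q))"
proof -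
  have eq: "{x :: complex ^ 'q. 0 < norm x \<and> norm x \<le> 1 \<and> x /\<^sub>R norm x \<in> sphere 0 1} = cball 0 1 - {0}"
    by auto
  have "emeasure lborel (cball 0 1 - {0} :: (complex ^ 'q) set) = emeasure lborel (cball 0 1 :: (complex ^ 'q) set)"
    by (subst emeasure_Diff) auto
  also have "\<dots> = ennreal (pi ^ CARD('q) / fact CARD('q))"
    using unit_ball_vol_even[of "CARD('q)"] by (simp add: emeasure_cball mult.commute[of _ 2])
  finally have v: "emeasure lborel (cball 0 1 - {0} :: (complex ^ 'q) set) =
      ennreal (pi ^ CARD('q) / fact CARD('q))" .
  have "real (2 * CARD('q)) * (pi ^ CARD('q) / fact CARD('q)) = sphere_area CARD('q)"
    using fact_reduce[of "CARD('q)", where 'a = real] by (simp add: sphere_area_def)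
  then show ?thesis
    by (subst emeasure_surface_measure; (subst eq)?)
      (simp_all add: v flip: ennreal_mult del: of_nat_mult)
qed

text \<open>
  A kernel is a function on all pairs of vectors, but only its values on pairs of unit
  vectors matter below.
\<close>

type_synonym 'q kernel = "(complex ^ 'q) \<times> (complex ^ 'q) \<Rightarrow> complex"

abbreviation surface_measure2 :: "((complex ^ 'q::finite) \<times> (complex ^ 'q)) measure" where
  "surface_measure2 \<equiv> surface_measure \<Otimes>\<^sub>M surface_measure"

definition L2_kernels :: "'q::finite kernel set" where
  "L2_kernels = {K \<in> borel_measurable surface_measure2.
     integrable surface_measure2 (\<lambda>p. (norm (K p))\<^sup>2)}"

definition zonal :: "'q::finite kernel \<Rightarrow> bool" where
  "zonal K \<longleftrightarrow> (\<forall>\<rho>. unitary_op \<rho> \<longrightarrow>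
     (\<forall>x\<in>sphere 0 1. \<forall>y\<in>sphere 0 1. K (\<rho> x, \<rho> y) = K (x, y)))"

text \<open>
  Elements of \<open>L\<^sup>2\<close> are functions up to equality almost everywhere, so an element is zonal
  if one of its representatives is a zonal function.
\<close>

definition zonal_L2_kernels :: "'q::finite kernel set" where
  "zonal_L2_kernels = {K \<in> L2_kernels. \<exists>Z\<in>L2_kernels. zonal Z \<and> (AE p in surface_measure2. K p = Z p)}"

definition kernel_conv :: "'q::finite kernel \<Rightarrow> 'q kernel \<Rightarrow> 'q kernel" where
  "kernel_conv K1 K2 = (\<lambda>(x, y).
     complex_of_real (1 / sphere_area CARD('q)) *
       (LINT \<xi>|surface_measure. K1 (x, \<xi>) * K2 (\<xi>, y)))"

end

theory Submission
  imports Defs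
begin

text \<open>
  Let \<open>Z\<close> be a zonal representative of \<open>J\<close>. The value of the convolution at \<open>(x, y)\<close> is the
  pairing of the two sections \<open>Z (x, _)\<close> and \<open>Z (_, y)\<close>, so by the Cauchy-Schwarz inequality it is
  continuous as soon as both sections are square integrable and vary continuously, as elements of L2
  of the sphere, with \<open>x\<close> and \<open>y\<close>.

  Zonality provides this continuity. If \<open>H\<close> is unitary and maps \<open>x\<close> to a fixed point \<open>c\<close>, then
  \<open>Z (x, \<xi>) = Z (c, H \<xi>)\<close>: moving \<open>x\<close> amounts to rotating one fixed function. The
  unitary group acts continuously on L2 (\<open>tendsto_L2_orthogonal\<close>), because the surface measure is
  rotation invariant (\<open>surface_measure_distr_orthogonal\<close>) and continuous functions are dense. What
  remains is a choice of \<open>H\<close> that depends continuously on \<open>x\<close> near a given point \<open>a\<close>: the complex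
  Householder reflection that maps \<open>x\<close> to \<open>c = - a\<close> (\<open>unitary_householder\<close>,
  \<open>tendsto_householder\<close>).

  Density is proved for L1, from the regularity of finite Borel measures
  (\<open>integrable_approximate_continuous\<close>), and transferred to L2 through the elementary inequality
  \<open>norm_diff_sq_le_signed_square\<close>. Finally, replacing \<open>J\<close> by \<open>Z\<close> changes the convolution only on a
  null set (\<open>kernel_conv_cong_AE\<close>).
\<close>

section \<open>Unitary reflections\<close>

lemma cinner_add_left: "cinner (x + y) z = cinner x z + cinner y z"
  by (simp add: cinner_def sum.distrib algebra_simps)

lemma cinner_diff_left: "cinner (x - y) z = cinner x z - cinner y z"
  by (simp add: cinner_def sum_subtractf algebra_simps)

lemma cinner_scale_left: "cinner (c *s x) z = c * cinner x z"
  by (simp add: cinner_def sum_distrib_left algebra_simps)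

lemma cnj_cinner: "cnj (cinner x y) = cinner y x"
  by (simp add: cinner_def mult.commute)

lemma cinner_diff_right: "cinner z (x - y) = cinner z x - cinner z y"
  by (simp add: cinner_def sum_subtractf algebra_simps)

lemma cinner_scale_right: "cinner z (c *s x) = cnj c * cinner z x"
  by (simp add: cinner_def sum_distrib_left algebra_simps)

lemma Re_cinner: "Re (cinner x y) = inner x y"
  by (simp add: cinner_def inner_vec_def inner_complex_def)

lemma cinner_self: "cinner x x = complex_of_real ((norm x)\<^sup>2)"
proof (rule complex_eqI)
  show "Im (cinner x x) = Im (complex_of_real ((norm x)\<^sup>2))"
    using cnj_cinner[of x x] by (simp add: complex_eq_iff)
qed (simp add: Re_cinner power2_norm_eq_inner)

lemma tendsto_cinner [tendsto_intros]:
  assumes "(f \<longlongrightarrow> a) F" "(g \<longlongrightarrow> b) F"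
  shows "((\<lambda>n. cinner (f n) (g n)) \<longlongrightarrow> cinner a b) F"
  unfolding cinner_def using assms by (intro tendsto_intros)

lemma tendsto_vector_smult [tendsto_intros]:
  fixes f :: "'b \<Rightarrow> complex" and g :: "'b \<Rightarrow> complex ^ 'q::finite"
  assumes "(f \<longlongrightarrow> a) F" "(g \<longlongrightarrow> b) F"
  shows "((\<lambda>n. f n *s g n) \<longlongrightarrow> a *s b) F"
  unfolding vector_scalar_mult_def using assms by (intro vec_tendstoI) (auto intro!: tendsto_intros)

lemma unitary_op_orthogonal:
  assumes "unitary_op \<rho>"
  shows "orthogonal_transformation \<rho>"
proof -
  interpret Vector_Spaces.linear "(*s)" "(*s)" \<rho>
    using assms by (simp add: unitary_op_def)
  have s: "c *\<^sub>R x = complex_of_real c *s x" for c and x :: "complex ^ 'a"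
    by (simp add: vec_eq_iff scaleR_conv_of_real[where 'a = complex])
  have "linear \<rho>"
    by (rule linearI) (simp_all add: add s scale)
  moreover have "\<rho> v \<bullet> \<rho> w = v \<bullet> w" for v w
    using assms by (simp add: unitary_op_def flip: Re_cinner)
  ultimately show ?thesis
    by (simp add: orthogonal_transformation_def)
qed

text \<open>
  The complex reflection along \<open>x - y\<close> that moves the unit vector \<open>x\<close> to the unit vector \<open>y\<close>.
  The denominator \<open>cinner x (x - y)\<close> makes the reflection unitary although it need not be an
  involution; for \<open>x = y\<close> the formula gives the identity.
\<close>

definition householder :: "complex ^ 'q::finite \<Rightarrow> complex ^ 'q \<Rightarrow> complex ^ 'q \<Rightarrow> complex ^ 'q" where
  "householder x y z = z - (cinner z (x - y) / cinner x (x - y)) *s (x - y)"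

text \<open>
  Subtracting a multiple of the projection onto \<open>u\<close> multiplies the component along \<open>u\<close> by
  \<open>1 - cinner u u / d\<close>; the hypothesis says that this number is \<open>- cnj d / d\<close>, which has modulus 1.
  If \<open>d = 0\<close>, division by zero yields the identity.
\<close>

lemma cinner_quasi_reflection:
  assumes "cinner u u = d + cnj d"
  shows "cinner (z - (cinner z u / d) *s u) (w - (cinner w u / d) *s u) = cinner z w"
proof (cases "d = 0")
  case False
  have "cinner u w = cnj (cinner w u)" by (simp only: cnj_cinner)
  with False assms show ?thesis
    by (simp add: cinner_diff_left cinner_diff_right cinner_scale_left cinner_scale_right field_simps)
qed simp

lemma cinner_diff_self:
  assumes "norm x = 1" "norm y = 1"
  shows "cinner (x - y) (x - y) = cinner x (x - y) + cnj (cinner x (x - y))"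
  using assms
  by (simp add: cinner_diff_left cinner_diff_right cinner_self[of x] cinner_self[of y] cnj_cinner)

lemma householder_apply:
  assumes "norm x = 1" "norm y = 1"
  shows "householder x y x = y"
proof (cases "cinner x (x - y) = 0")
  case True
  then have "x = y"
    using cinner_diff_self[OF assms] cinner_self[of "x - y"] by simp
  then show ?thesis by (simp add: householder_def)
qed (simp add: householder_def)

lemma unitary_householder:
  fixes x y :: "complex ^ 'q::finite"
  assumes "norm x = 1" "norm y = 1"
  shows "unitary_op (householder x y)"
proof -
  have lin: "Vector_Spaces.linear (*s) (*s) (householder x y)"
    by unfold_locales
      (auto simp: householder_def cinner_add_left cinner_scale_left vec_eq_iff add_divide_distrib
        algebra_simps)
  have iso: "cinner (householder x y z) (householder x y w) = cinner z w" for z w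
    unfolding householder_def by (rule cinner_quasi_reflection) (rule cinner_diff_self[OF assms])
  have "surj (householder x y)"
  proof -
    interpret Vector_Spaces.linear "(*s)" "(*s)" "householder x y" by (fact lin)
    have "householder x y z = 0 \<Longrightarrow> z = 0" for z
      using iso[of z z] by (simp add: cinner_self)
    then have "inj (householder x y)"
      by (intro injI) (metis diff eq_iff_diff_eq_0)
    then show ?thesis using lin vec.linear_inj_imp_surj by blast
  qed
  with lin iso show ?thesis by (simp add: unitary_op_def)
qed

text \<open>
  The reflection need not depend continuously on its endpoints where they coincide, so the target is
  the antipode \<open>- a\<close> rather than \<open>a\<close> itself: the denominator then tends to \<open>2\<close>.
\<close>

lemma tendsto_householder:
  fixes x :: "'b \<Rightarrow> complex ^ 'q::finite"
  assumes "(x \<longlongrightarrow> a) F" "norm a = 1"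
  shows "((\<lambda>n. householder (x n) (- a) z) \<longlongrightarrow> householder a (- a) z) F"
proof -
  have "cinner a (a - (- a)) = 2"
    using assms(2) cinner_diff_right[of a a "- a"] cinner_diff_right[of a 0 a]
    by (simp add: cinner_self[of a]) (simp add: cinner_def)
  then show ?thesis
    unfolding householder_def using assms(1) by (intro tendsto_intros) auto
qed

section \<open>Rotation invariance of Lebesgue and surface measure\<close>

lemma nn_integral_lborel_translation:
  fixes f :: "'a::euclidean_space \<Rightarrow> ennreal"
  assumes [measurable]: "f \<in> borel_measurable borel"
  shows "(\<integral>\<^sup>+ x. f (a + x) \<partial>lborel) = (\<integral>\<^sup>+ x. f x \<partial>lborel)"
  by (subst lborel_distr_plus[of a, symmetric], subst nn_integral_distr) simp_all

lemma orthogonal_transformation_borel_measurable: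
  fixes T :: "'a::euclidean_space \<Rightarrow> 'a"
  assumes "orthogonal_transformation T"
  shows "T \<in> borel_measurable borel"
  using linear_continuous_on orthogonal_transformation_linear[OF assms]
  by (intro borel_measurable_continuous_onI) (simp add: linear_conv_bounded_linear)

text \<open>
  This is the uniqueness argument for Haar measure. The double integral of
  \<open>1\<^sub>B y * 1\<^sub>A (T x + y)\<close>, with \<open>B\<close> the unit ball, is computed in two ways. Integrating over \<open>x\<close>
  first and absorbing \<open>y\<close> into \<open>x\<close> gives the volume of \<open>B\<close> times the measure of \<open>A\<close> under the
  image of \<open>lborel\<close>. Translating \<open>y\<close> by \<open>T x\<close> instead turns the integral over \<open>x\<close> into the volume
  of \<open>{x. norm (y - T x) \<le> 1}\<close>, which is again a unit ball because \<open>T\<close> is an isometry; this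
  gives the volume of \<open>B\<close> times the Lebesgue measure of \<open>A\<close>.
\<close>

lemma lborel_distr_orthogonal:
  fixes T :: "'a::euclidean_space \<Rightarrow> 'a"
  assumes T: "orthogonal_transformation T"
  shows "distr lborel borel T = lborel"
proof (rule measure_eqI)
  fix A assume "A \<in> sets (distr lborel borel T)"
  then have [measurable]: "A \<in> sets borel" by simp
  have lin: "linear T" using T by (rule orthogonal_transformation_linear)
  have [measurable]: "T \<in> borel_measurable borel"
    by (rule orthogonal_transformation_borel_measurable[OF T])
  define S where "S = inv T"
  have TS: "T (S y) = y" for y
    unfolding S_def using orthogonal_transformation_surj[OF T] by (rule surj_f_inv_f)
  have n: "norm (T x) = norm x" for x using T by (rule orthogonal_transformation_norm)
  let ?B = "cball 0 1 :: 'a set"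
  have [measurable]: "?B \<in> sets borel" by simp
  let ?V = "ennreal (unit_ball_vol (real DIM('a)))"
  have V: "emeasure lborel (cball c 1 :: 'a set) = ?V" for c
    by (simp add: emeasure_cball)
  have "emeasure (distr lborel borel T) A * ?V = (\<integral>\<^sup>+ y. (\<integral>\<^sup>+ x. indicator ?B y * indicator A (T x) \<partial>lborel) \<partial>lborel)"
  proof -
    have 1: "(\<integral>\<^sup>+ x. indicator A (T x) \<partial>lborel) = emeasure (distr lborel borel T) A"
      by (subst nn_integral_distr[symmetric, where M' = borel and f = "indicator A"]) simp_all
    have 2: "(\<integral>\<^sup>+ x. c * indicator A (T x) \<partial>lborel) = c * (\<integral>\<^sup>+ x. indicator A (T x) \<partial>lborel)"
      for c :: ennreal
      by (rule nn_integral_cmult) measurable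
    have 3: "(\<integral>\<^sup>+ y. indicator ?B y * c \<partial>lborel) = ?V * c" for c :: ennreal
      by (subst nn_integral_multc) (simp_all add: V borel_measurable_indicator)
    show ?thesis
      unfolding 2 1 3 by (rule mult.commute)
  qed
  also have "\<dots> = (\<integral>\<^sup>+ y. (\<integral>\<^sup>+ x. indicator ?B y * indicator A (T x + y) \<partial>lborel) \<partial>lborel)"
  proof (rule nn_integral_cong)
    fix y :: 'a
    have "(\<integral>\<^sup>+ x. indicator ?B y * indicator A (T x) \<partial>lborel) =
        (\<integral>\<^sup>+ x. indicator ?B y * indicator A (T (S y + x)) \<partial>lborel)"
      by (rule nn_integral_lborel_translation[symmetric]) measurable
    then show "(\<integral>\<^sup>+ x. indicator ?B y * indicator A (T x) \<partial>lborel) =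
        (\<integral>\<^sup>+ x. indicator ?B y * indicator A (T x + y) \<partial>lborel)"
      by (simp add: linear_add[OF lin] TS add.commute)
  qed
  also have "\<dots> = (\<integral>\<^sup>+ x. (\<integral>\<^sup>+ y. indicator ?B y * indicator A (T x + y) \<partial>lborel) \<partial>lborel)"
    by (rule lborel_pair.Fubini') measurable
  also have "\<dots> = (\<integral>\<^sup>+ x. (\<integral>\<^sup>+ y. indicator ?B (y - T x) * indicator A y \<partial>lborel) \<partial>lborel)"
  proof (rule nn_integral_cong)
    fix x :: 'a
    show "(\<integral>\<^sup>+ y. indicator ?B y * indicator A (T x + y) \<partial>lborel) =
        (\<integral>\<^sup>+ y. indicator ?B (y - T x) * indicator A y \<partial>lborel)"
      using nn_integral_lborel_translation[of "\<lambda>y. indicator ?B (y - T x) * indicator A y" "T x"] by simp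
  qed
  also have "\<dots> = (\<integral>\<^sup>+ y. (\<integral>\<^sup>+ x. indicator ?B (y - T x) * indicator A y \<partial>lborel) \<partial>lborel)"
    by (rule lborel_pair.Fubini'[symmetric]) measurable
  also have "\<dots> = (\<integral>\<^sup>+ y. (\<integral>\<^sup>+ x. indicator (cball (S y) 1) x * indicator A y \<partial>lborel) \<partial>lborel)"
  proof -
    have "(indicator ?B (y - T x) :: ennreal) = indicator (cball (S y) 1) x" for x y
      using n[of "S y - x"] norm_minus_commute[of y "T x"]
      by (simp add: indicator_def dist_norm linear_diff[OF lin] TS)
    then show ?thesis by simp
  qed
  also have "\<dots> = emeasure lborel A * ?V"
  proof -
    have 1: "(\<integral>\<^sup>+ x. indicator (cball (S y) 1) x * c \<partial>lborel) = ?V * c" for c :: ennreal and y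
      by (subst nn_integral_multc) (simp_all add: V borel_measurable_indicator)
    have 2: "(\<integral>\<^sup>+ y. ?V * indicator A y \<partial>lborel) = ?V * emeasure lborel A"
      by (simp add: nn_integral_cmult_indicator)
    show ?thesis
      unfolding 1 2 by (rule mult.commute)
  qed
  finally show "emeasure (distr lborel borel T) A = emeasure lborel A"
    using unit_ball_vol_pos[of "real DIM('a)"] mult_right_ennreal_cancel
    by (metis of_nat_0_le_iff not_le)
qed simp

section \<open>Continuous functions in L1\<close>

lemma integrable_bounded_continuous:
  fixes g :: "'a::topological_space \<Rightarrow> 'b::{banach, second_countable_topology}"
  assumes M: "finite_measure M" "sets M = sets borel" and g: "continuous_on UNIV g" "bounded (range g)"
  shows "integrable M g"
proof -
  interpret finite_measure M by fact
  have "g \<in> borel_measurable M"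
    using borel_measurable_continuous_onI[OF g(1)] measurable_cong_sets[OF M(2) refl] by blast
  then show ?thesis using g(2) by (auto simp: bounded_iff intro!: integrable_const_bound)
qed

text \<open>
  The functions that can be approximated form a set closed under sums and dominated limits, so
  indicators suffice. For an indicator of \<open>A\<close>, outer regularity applied to \<open>A\<close> and to its
  complement encloses \<open>A\<close> between a closed and an open set of nearly equal measure, and a
  Urysohn function for this pair differs from the indicator only between them.
\<close>

lemma integrable_approximate_continuous:
  fixes f :: "'a::euclidean_space \<Rightarrow> 'b::{banach, second_countable_topology}"
  assumes M: "finite_measure M" "sets M = sets borel" and f: "integrable M f" and "0 < e"
  shows "\<exists>g. continuous_on UNIV g \<and> bounded (range g) \<and> (LINT x|M. norm (f x - g x)) < e"
  using f \<open>0 < e\<close>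
proof (induction arbitrary: e rule: integrable_induct)
  case (base A c)
  interpret finite_measure M by fact
  have space: "space M = UNIV" using sets_eq_imp_space_eq[OF M(2)] by simp
  have A[measurable]: "A \<in> sets borel" "A \<in> sets M" using base(1) M(2) by auto
  \<comment> \<open>The summand 1 covers the case \<open>c = 0\<close>.\<close>
  define \<delta> where "\<delta> = e / (norm c + 1)"
  have \<delta>: "\<delta> > 0" using base(3) by (simp add: \<delta>_def add_nonneg_pos)
  have outer: "\<exists>U. B \<subseteq> U \<and> open U \<and> measure M U < measure M B + \<delta> / 2" if B: "B \<in> sets borel" for B
  proof -
    have "emeasure M B < ennreal (measure M B + \<delta> / 2)"
      using \<delta> by (simp add: emeasure_eq_measure ennreal_less_iff)
    then obtain U where "B \<subseteq> U" "open U" "emeasure M U < ennreal (measure M B + \<delta> / 2)"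
      using outer_regular[OF M(2) _ B] emeasure_finite by (auto simp: INF_less_iff)
    then show ?thesis by (auto simp: emeasure_eq_measure ennreal_less_iff)
  qed
  obtain U where U: "A \<subseteq> U" "open U" "measure M U < measure M A + \<delta> / 2"
    using outer[of A] A by auto
  obtain V where V: "- A \<subseteq> V" "open V" "measure M V < measure M (- A) + \<delta> / 2"
    using outer[of "- A"] A(1) by (auto simp: borel_comp)
  \<comment> \<open>Complementing turns the open set around \<open>- A\<close> into a closed set inside \<open>A\<close>.\<close>
  define C where "C = - V"
  have C: "C \<subseteq> A" "closed C" using V(1,2) by (auto simp: C_def)
  have [measurable]: "U \<in> sets M" "C \<in> sets M" "V \<in> sets M"
    using U(2) C(2) V(2) M(2) by auto
  have "measure M A < measure M C + \<delta> / 2"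
    using V(3) finite_measure_compl[of V] finite_measure_compl[of A] by (simp add: space C_def Compl_eq_Diff_UNIV)
  then have UC: "measure M (U - C) < \<delta>"
    using U(1,3) C(1) by (subst finite_measure_Diff) auto
  obtain h :: "'a \<Rightarrow> real" where h: "continuous_on UNIV h" "\<And>x. h x \<in> closed_segment 0 1"
      "\<And>x. x \<in> - U \<Longrightarrow> h x = 0" "\<And>x. x \<in> C \<Longrightarrow> h x = 1"
    using Urysohn[of "- U" C 0 "1::real"] U C by (auto simp: closed_Compl)
  have h01: "0 \<le> h x" "h x \<le> 1" for x using h(2)[of x] by (auto simp: closed_segment_eq_real_ivl)
  have "(LINT x|M. norm (indicator A x *\<^sub>R c - h x *\<^sub>R c)) \<le> (LINT x|M. norm c * indicator (U - C) x)"
  proof (rule integral_mono')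
    show "integrable M (\<lambda>x. norm c * indicator (U - C) x)"
      by (intro integrable_mult_right integrable_real_indicator) (simp_all add: emeasure_eq_measure)
    show "norm (indicator A x *\<^sub>R c - h x *\<^sub>R c) \<le> norm c * indicator (U - C) x" for x
    proof -
      have "\<bar>indicator A x - h x\<bar> \<le> indicator (U - C) x"
        using h(3,4)[of x] h01[of x] U(1) C(1) by (auto simp: indicator_def)
      then show ?thesis
        by (simp add: mult.commute mult_left_mono flip: scaleR_diff_left)
    qed
  qed simp
  also have "\<dots> = norm c * measure M (U - C)"
    by (simp add: space)
  also have "\<dots> \<le> norm c * \<delta>" using UC by (intro mult_left_mono) auto
  also have "\<dots> < e" 
  proof -
    have "(norm c + 1) * \<delta> = e" by (simp add: \<delta>_def add_nonneg_eq_0_iff)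
    then show ?thesis using \<delta> by (simp add: algebra_simps)
  qed
  finally show ?case
    using h(1) h01 
    by (intro exI[of _ "\<lambda>x. h x *\<^sub>R c"])
       (auto intro!: continuous_intros boundedI[where B = "norm c"] mult_left_le_one_le)
next
  case (add f1 f2)
  interpret finite_measure M by fact
  obtain g1 g2 where g: "continuous_on UNIV g1" "bounded (range g1)" "(LINT x|M. norm (f1 x - g1 x)) < e / 2"
     "continuous_on UNIV g2" "bounded (range g2)" "(LINT x|M. norm (f2 x - g2 x)) < e / 2"
    using add.IH(1)[of "e/2"] add.IH(2)[of "e/2"] \<open>0 < e\<close> by auto
  note int = integrable_bounded_continuous[OF M]
  have "(LINT x|M. norm (f1 x + f2 x - (g1 x + g2 x))) \<le> 
     (LINT x|M. norm (f1 x - g1 x) + norm (f2 x - g2 x))"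
    using add.hyps int[OF g(1,2)] int[OF g(4,5)]
    by (intro integral_mono) (auto intro!: norm_diff_triangle_ineq)
  also have "\<dots> < e"
    using add.hyps int[OF g(1,2)] int[OF g(4,5)] g(3,6) by (subst Bochner_Integration.integral_add) auto
  finally show ?case
    using g by (intro exI[of _ "\<lambda>x. g1 x + g2 x"]) (auto intro!: continuous_intros bounded_plus_comp)
next
  case (lim f s)
  interpret finite_measure M by fact
  note int = integrable_bounded_continuous[OF M]
  have "(\<lambda>i. LINT x|M. norm (f x - s i x)) \<longlonglongrightarrow> (LINT x|M. 0)"
  proof (rule integral_dominated_convergence[where w = "\<lambda>x. 3 * norm (f x)"])
    show "AE x in M. (\<lambda>i. norm (f x - s i x)) \<longlonglongrightarrow> 0"
      using lim.hyps(2) by (intro AE_I2) (auto intro!: tendsto_eq_intros)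
    show "AE x in M. norm (norm (f x - s i x)) \<le> 3 * norm (f x)" for i
      using lim.hyps(3)[of _ i] norm_triangle_ineq4[of "f _" "s i _"] by (intro AE_I2) (force intro: order_trans)
  qed (use lim.hyps(1,4) in auto)
  then obtain i where i: "(LINT x|M. norm (f x - s i x)) < e / 2"
    using order_tendstoD(2)[of _ _ _ "e / 2"] \<open>0 < e\<close> by (fastforce simp: eventually_sequentially)
  obtain g where g: "continuous_on UNIV g" "bounded (range g)" "(LINT x|M. norm (s i x - g x)) < e / 2"
    using lim.IH[of "e / 2" i] \<open>0 < e\<close> by auto
  have "(LINT x|M. norm (f x - g x)) \<le> (LINT x|M. norm (f x - s i x) + norm (s i x - g x))"
    using lim.hyps(1,4) int[OF g(1,2)] norm_triangle_ineq[of "f x - s i x" "s i x - g x" for x]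
    by (intro integral_mono) auto
  also have "\<dots> < e"
    using lim.hyps(1,4) int[OF g(1,2)] g(3) i by (subst Bochner_Integration.integral_add) auto
  finally show ?case using g by blast
qed

section \<open>Integrals over the sphere\<close>

lemma finite_measure_surface_measure: "finite_measure (surface_measure :: (complex ^ 'q::finite) measure)"
  by (rule finite_measureI) (simp add: surface_measure_sphere)

lemma measurable_surface_measure_orthogonal:
  fixes T :: "complex ^ 'q::finite \<Rightarrow> complex ^ 'q"
  assumes T: "orthogonal_transformation T"
  shows "T \<in> surface_measure \<rightarrow>\<^sub>M surface_measure"
proof -
  have "T \<in> borel_measurable borel"
    by (rule orthogonal_transformation_borel_measurable[OF T])
  then have "T \<in> restrict_space borel (sphere 0 1) \<rightarrow>\<^sub>M restrict_space borel (sphere 0 1)"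
    by (rule measurable_restrict_space3) (simp add: orthogonal_transformation_norm[OF T])
  moreover have "measurable surface_measure (surface_measure :: (complex ^ 'q) measure) =
      measurable (restrict_space borel (sphere 0 1)) (restrict_space borel (sphere 0 1 :: (complex ^ 'q) set))"
    by (rule measurable_cong_sets) simp_all
  ultimately show ?thesis by blast
qed

lemma surface_measure_distr_orthogonal:
  fixes T :: "complex ^ 'q::finite \<Rightarrow> complex ^ 'q"
  assumes T: "orthogonal_transformation T"
  shows "distr surface_measure surface_measure T = surface_measure"
proof (rule measure_eqI)
  fix A assume "A \<in> sets (distr surface_measure surface_measure T)"
  then have A': "A \<in> sets surface_measure" by simp
  then have A: "A \<in> sets borel" "A \<subseteq> sphere 0 1"
    by (auto simp: sets_restrict_space_iff)
  let ?cone = "\<lambda>A. {x :: complex ^ 'q. 0 < norm x \<and> norm x \<le> 1 \<and> x /\<^sub>R norm x \<in> A}"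
  let ?A = "T -` A \<inter> sphere 0 1"
  have lin: "linear T" using T by (rule orthogonal_transformation_linear)
  have n: "norm (T x) = norm x" for x using T by (rule orthogonal_transformation_norm)
  have [measurable]: "T \<in> borel_measurable borel"
    by (rule orthogonal_transformation_borel_measurable[OF T])
  have [measurable]: "A \<in> sets borel" by fact
  have cone: "?cone A \<in> sets borel" by measurable
  have "T -` A \<inter> space borel \<in> sets borel" by (rule measurable_sets) measurable
  then have TA: "?A \<in> sets borel" by (intro sets.Int) auto
  have eq: "?cone ?A = T -` ?cone A"
  proof (rule set_eqI)
    fix x
    have "T x = 0 \<longleftrightarrow> x = 0" by (metis n norm_eq_zero)
    then show "x \<in> ?cone ?A \<longleftrightarrow> x \<in> T -` ?cone A"
      by (cases "x = 0") (simp_all add: n linear_scale[OF lin])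
  qed
  have "emeasure (distr surface_measure surface_measure T) A = emeasure surface_measure ?A"
    by (simp add: emeasure_distr[OF measurable_surface_measure_orthogonal[OF T] A'])
  also have "\<dots> = ennreal (real (2 * CARD('q))) * emeasure lborel (T -` ?cone A)"
    by (subst emeasure_surface_measure[OF TA]) (auto simp only: eq Int_lower2)
  also have "emeasure lborel (T -` ?cone A) = emeasure (distr lborel borel T) (?cone A)"
    using cone by (simp add: emeasure_distr)
  also have "\<dots> = emeasure lborel (?cone A)"
    by (simp add: lborel_distr_orthogonal[OF T])
  finally show "emeasure (distr surface_measure surface_measure T) A = emeasure surface_measure A"
    by (simp add: emeasure_surface_measure[OF A])
qed simp

lemma
  fixes f :: "complex ^ 'q::finite \<Rightarrow> 'b::{banach, second_countable_topology}"
    and T :: "complex ^ 'q \<Rightarrow> complex ^ 'q"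
  assumes T: "orthogonal_transformation T" and f: "f \<in> borel_measurable surface_measure"
  shows integral_surface_measure_orthogonal:
      "(LINT x|surface_measure. f (T x)) = (LINT x|surface_measure. f x)"
    and integrable_surface_measure_orthogonal:
      "integrable surface_measure (\<lambda>x. f (T x)) \<longleftrightarrow> integrable surface_measure f"
  using integral_distr[OF measurable_surface_measure_orthogonal[OF T] f]
    integrable_distr_eq[OF measurable_surface_measure_orthogonal[OF T] f]
  by (simp_all add: surface_measure_distr_orthogonal[OF T])

lemma borel_imp_surface_measurable:
  assumes "g \<in> borel_measurable borel"
  shows "g \<in> borel_measurable (surface_measure :: (complex ^ 'q::finite) measure)"
proof -
  have "g \<in> borel_measurable (restrict_space borel (sphere 0 1))"
    using assms by (rule measurable_restrict_space1)
  then show ?thesis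
    using measurable_cong_sets[OF sets_surface_measure refl] by blast
qed

text \<open>
  The surface measure lives on the Borel sets of the sphere only, so the approximation is carried out
  for its image under the inclusion into the whole space.
\<close>

lemma surface_approximate_continuous:
  fixes f :: "complex ^ 'q::finite \<Rightarrow> 'b::{banach, second_countable_topology}"
  assumes f: "integrable surface_measure f" and "0 < e"
  shows "\<exists>g. continuous_on UNIV g \<and> bounded (range g) \<and> (LINT x|surface_measure. norm (f x - g x)) < e"
proof -
  let ?S = "surface_measure :: (complex ^ 'q) measure"
  let ?M = "distr ?S borel (\<lambda>x. x)"
  let ?f = "\<lambda>x. indicator (sphere 0 1) x *\<^sub>R f x"
  interpret finite_measure ?S by (rule finite_measure_surface_measure)
  have id: "(\<lambda>x. x) \<in> ?S \<rightarrow>\<^sub>M borel" by (rule borel_imp_surface_measurable) simp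
  have "f \<in> borel_measurable (restrict_space borel (sphere 0 1))"
    using borel_measurable_integrable[OF f] measurable_cong_sets[OF sets_surface_measure refl] by blast
  then have fm[measurable]: "?f \<in> borel_measurable borel"
    by (simp add: borel_measurable_restrict_space_iff)
  have "integrable ?S ?f"
    using f by (rule Bochner_Integration.integrable_cong[THEN iffD1, rotated -1]) auto
  then have "integrable ?M ?f"
    by (subst integrable_distr_eq[OF id fm])
  from integrable_approximate_continuous[OF finite_measure_distr[OF id] _ this \<open>0 < e\<close>]
  obtain g where g: "continuous_on UNIV g" "bounded (range g)" "(LINT x|?M. norm (?f x - g x)) < e"
    by auto
  have [measurable]: "g \<in> borel_measurable borel"
    using g(1) by (rule borel_measurable_continuous_onI)
  have "(LINT x|?M. norm (?f x - g x)) = (LINT x|?S. norm (?f x - g x))"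
    by (rule integral_distr[OF id]) measurable
  also have "\<dots> = (LINT x|?S. norm (f x - g x))"
    by (rule Bochner_Integration.integral_cong) auto
  finally show ?thesis using g by auto
qed

text \<open>
  For a continuous function this is dominated convergence. A general \<open>f\<close> is replaced by a continuous
  \<open>g\<close>, and by invariance of the measure the error of the replacement is the same after composition
  with any of the transformations.
\<close>

lemma tendsto_L1_orthogonal:
  fixes f :: "complex ^ 'q::finite \<Rightarrow> 'b::{banach, second_countable_topology}"
    and T' :: "complex ^ 'q \<Rightarrow> complex ^ 'q"
  assumes f: "integrable surface_measure f"
    and T: "\<And>n. orthogonal_transformation (T n)" "orthogonal_transformation T'"
    and lim: "\<And>x. (\<lambda>n. T n x) \<longlonglongrightarrow> T' x"
  shows "(\<lambda>n. LINT x|surface_measure. norm (f (T n x) - f (T' x))) \<longlonglongrightarrow> 0"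
proof (rule order_tendstoI)
  fix e :: real assume e: "0 < e"
  let ?S = "surface_measure :: (complex ^ 'q) measure"
  interpret finite_measure ?S by (rule finite_measure_surface_measure)
  obtain g where g: "continuous_on UNIV g" "bounded (range g)" "(LINT x|?S. norm (f x - g x)) < e / 3"
    using surface_approximate_continuous[OF f, of "e / 3"] e by auto
  obtain B where B: "\<And>x. norm (g x) \<le> B" using g(2) by (auto simp: bounded_iff)
  have gm[measurable]: "g \<in> borel_measurable ?S"
    by (intro borel_imp_surface_measurable borel_measurable_continuous_onI g)
  have gi: "integrable ?S g"
    using B by (intro integrable_const_bound[of _ B]) auto
  have Tm: "U \<in> ?S \<rightarrow>\<^sub>M ?S" if "orthogonal_transformation U" for U :: "complex ^ 'q \<Rightarrow> complex ^ 'q"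
    by (rule measurable_surface_measure_orthogonal[OF that])
  note [measurable] = Tm[OF T(1)] Tm[OF T(2)]
  have "(\<lambda>n. LINT x|?S. norm (g (T n x) - g (T' x))) \<longlonglongrightarrow> (LINT x|?S. 0)"
  proof (rule integral_dominated_convergence[where w = "\<lambda>x. 2 * B"])
    show "AE x in ?S. (\<lambda>n. norm (g (T n x) - g (T' x))) \<longlonglongrightarrow> 0"
    proof (rule AE_I2)
      fix x
      have "(\<lambda>n. g (T n x)) \<longlonglongrightarrow> g (T' x)"
        using continuous_on_tendsto_compose[OF g(1) lim] by simp
      then show "(\<lambda>n. norm (g (T n x) - g (T' x))) \<longlonglongrightarrow> 0"
        by (intro tendsto_norm_zero LIM_zero)
    qed
    show "AE x in ?S. norm (norm (g (T n x) - g (T' x))) \<le> 2 * B" for n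
    proof (rule AE_I2)
      fix x
      show "norm (norm (g (T n x) - g (T' x))) \<le> 2 * B"
        using norm_triangle_ineq4[of "g (T n x)" "g (T' x)"] B[of "T n x"] B[of "T' x"] by simp
    qed
  qed simp_all
  then have "eventually (\<lambda>n. (LINT x|?S. norm (g (T n x) - g (T' x))) < e / 3) sequentially"
    using order_tendstoD(2)[of _ "0::real" sequentially "e / 3"] e by simp
  then show "eventually (\<lambda>n. (LINT x|?S. norm (f (T n x) - f (T' x))) < e) sequentially"
  proof eventually_elim
    case (elim n)
    have d: "integrable ?S (\<lambda>x. norm (f (U x) - g (U x)))"
        "(LINT x|?S. norm (f (U x) - g (U x))) < e / 3" if "orthogonal_transformation U" for U :: "complex ^ 'q \<Rightarrow> complex ^ 'q"
      using integrable_surface_measure_orthogonal[OF that, of "\<lambda>x. norm (f x - g x)"]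
        integral_surface_measure_orthogonal[OF that, of "\<lambda>x. norm (f x - g x)"] f gi g(3)
      by simp_all
    have i: "integrable ?S (\<lambda>x. f (U x))" "integrable ?S (\<lambda>x. g (U x))"
      if "orthogonal_transformation U" for U :: "complex ^ 'q \<Rightarrow> complex ^ 'q"
      using integrable_surface_measure_orthogonal[OF that, of f] integrable_surface_measure_orthogonal[OF that, of g] f gi
      by simp_all
    note ii = i[OF T(1)] i[OF T(2)] d(1)[OF T(1)] d(1)[OF T(2)]
    have "(LINT x|?S. norm (f (T n x) - f (T' x))) \<le>
        (LINT x|?S. norm (f (T n x) - g (T n x)) + norm (g (T n x) - g (T' x)) + norm (f (T' x) - g (T' x)))"
    proof (rule integral_mono)
      fix x
      show "norm (f (T n x) - f (T' x)) \<le>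
          norm (f (T n x) - g (T n x)) + norm (g (T n x) - g (T' x)) + norm (f (T' x) - g (T' x))"
        using norm_triangle_ineq4[of "f (T n x) - g (T n x) + (g (T n x) - g (T' x))" "f (T' x) - g (T' x)"]
          norm_triangle_ineq[of "f (T n x) - g (T n x)" "g (T n x) - g (T' x)"] by simp
    qed (use ii in auto)
    also have "\<dots> = (LINT x|?S. norm (f (T n x) - g (T n x))) + (LINT x|?S. norm (g (T n x) - g (T' x))) +
        (LINT x|?S. norm (f (T' x) - g (T' x)))"
      using ii by (subst Bochner_Integration.integral_add; (subst Bochner_Integration.integral_add)?) auto
    also have "\<dots> < e" using elim d(2)[OF T(1)[of n]] d(2)[OF T(2)] by simp
    finally show ?case .
  qed
next
  fix e :: real assume "e < 0"
  then show "eventually (\<lambda>n. e < (LINT x|surface_measure. norm (f (T n x) - f (T' x)))) sequentially"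
    by (intro always_eventually allI less_le_trans[OF _ integral_nonneg_AE]) auto
qed

text \<open>
  The inverse of the map \<open>a \<mapsto> norm a *\<^sub>R a\<close> is Hoelder continuous with exponent 1/2. Since this map
  turns square integrable functions into integrable ones and commutes with composition, it transfers
  convergence results from L1 to L2. The estimate follows by pairing the difference on the right
  with \<open>a - b\<close>.
\<close>

lemma norm_diff_sq_le_signed_square:
  fixes a b :: "'a::real_inner"
  shows "(norm (a - b))\<^sup>2 \<le> 2 * norm (norm a *\<^sub>R a - norm b *\<^sub>R b)"
proof (cases "a = b")
  case False
  define s where "s = norm a + norm b"
  let ?d = "norm (a - b)" and ?D = "norm (norm a *\<^sub>R a - norm b *\<^sub>R b)"
  have d: "?d\<^sup>2 = (norm a)\<^sup>2 + (norm b)\<^sup>2 - 2 * inner a b"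
    unfolding power2_norm_eq_inner by (simp add: inner_diff_left inner_diff_right inner_commute)
  have i: "inner (norm a *\<^sub>R a - norm b *\<^sub>R b) (a - b) =
      norm a * ((norm a)\<^sup>2 - inner a b) + norm b * ((norm b)\<^sup>2 - inner a b)"
    unfolding power2_norm_eq_inner by (simp add: inner_diff_left inner_diff_right inner_commute algebra_simps)
  have "2 * (u * (u\<^sup>2 - c) + v * (v\<^sup>2 - c)) = (u + v) * (u\<^sup>2 + v\<^sup>2 - 2 * c) + (u + v) * (u - v)\<^sup>2"
    for u v c :: real by algebra
  then have "2 * inner (norm a *\<^sub>R a - norm b *\<^sub>R b) (a - b) = s * ?d\<^sup>2 + s * (norm a - norm b)\<^sup>2"
    unfolding d i s_def by blast
  moreover have "0 \<le> s * (norm a - norm b)\<^sup>2" by (simp add: s_def)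
  ultimately have "s * ?d\<^sup>2 \<le> 2 * inner (norm a *\<^sub>R a - norm b *\<^sub>R b) (a - b)" by linarith
  also have "\<dots> \<le> 2 * (?D * ?d)" by (intro mult_left_mono norm_cauchy_schwarz) simp
  finally have "(s * ?d) * ?d \<le> (2 * ?D) * ?d" by (simp add: power2_eq_square)
  then have "s * ?d \<le> 2 * ?D" using False by (simp add: mult_le_cancel_right)
  moreover have "?d * ?d \<le> s * ?d"
    unfolding s_def by (intro mult_right_mono norm_triangle_ineq4) simp
  ultimately show ?thesis by (simp add: power2_eq_square)
qed simp

lemma tendsto_L2_orthogonal:
  fixes f :: "complex ^ 'q::finite \<Rightarrow> complex"
    and T' :: "complex ^ 'q \<Rightarrow> complex ^ 'q"
  assumes f: "f \<in> borel_measurable surface_measure" "integrable surface_measure (\<lambda>x. (norm (f x))\<^sup>2)"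
    and T: "\<And>n. orthogonal_transformation (T n)" "orthogonal_transformation T'"
    and lim: "\<And>x. (\<lambda>n. T n x) \<longlonglongrightarrow> T' x"
  shows "(\<lambda>n. LINT x|surface_measure. (norm (f (T n x) - f (T' x)))\<^sup>2) \<longlonglongrightarrow> 0"
proof -
  let ?S = "surface_measure :: (complex ^ 'q) measure"
  \<comment> \<open>\<open>F\<close> has modulus \<open>(norm (f x))\<^sup>2\<close>, so it is integrable.\<close>
  define F where "F x = norm (f x) *\<^sub>R f x" for x
  note [measurable] = f(1)
  have [measurable]: "F \<in> borel_measurable ?S" unfolding F_def by measurable
  have F: "integrable ?S F"
    by (rule Bochner_Integration.integrable_bound[OF f(2)]) (simp_all add: F_def power2_eq_square)
  have FU: "integrable ?S (\<lambda>x. F (U x))" if "orthogonal_transformation U" for U :: "complex ^ 'q \<Rightarrow> complex ^ 'q"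
    using F integrable_surface_measure_orthogonal[OF that, of F] by simp
  have "(\<lambda>n. 2 * (LINT x|?S. norm (F (T n x) - F (T' x)))) \<longlonglongrightarrow> 2 * 0"
    by (intro tendsto_mult tendsto_const tendsto_L1_orthogonal F T lim)
  then have *: "(\<lambda>n. LINT x|?S. 2 * norm (F (T n x) - F (T' x))) \<longlonglongrightarrow> 0"
    by simp
  show ?thesis
  proof (rule tendsto_sandwich[OF always_eventually always_eventually tendsto_const *]; intro allI)
    fix n
    show "0 \<le> (LINT x|?S. (norm (f (T n x) - f (T' x)))\<^sup>2)" by (intro integral_nonneg_AE) simp
    show "(LINT x|?S. (norm (f (T n x) - f (T' x)))\<^sup>2) \<le> (LINT x|?S. 2 * norm (F (T n x) - F (T' x)))"
      using FU[OF T(1)[of n]] FU[OF T(2)]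
      by (intro integral_mono') (auto simp: F_def norm_diff_sq_le_signed_square)
  qed
qed

lemma Cauchy_Schwarz_integral:
  fixes f g :: "'a \<Rightarrow> complex"
  assumes f: "f \<in> borel_measurable M" "integrable M (\<lambda>x. (norm (f x))\<^sup>2)"
    and g: "g \<in> borel_measurable M" "integrable M (\<lambda>x. (norm (g x))\<^sup>2)"
  shows "integrable M (\<lambda>x. f x * g x)"
    and "(norm (LINT x|M. f x * g x))\<^sup>2 \<le> (LINT x|M. (norm (f x))\<^sup>2) * (LINT x|M. (norm (g x))\<^sup>2)"
proof -
  note [measurable] = f(1) g(1)
  define A where "A = (LINT x|M. (norm (f x))\<^sup>2)"
  define B where "B = (LINT x|M. (norm (g x))\<^sup>2)"
  define P where "P = (LINT x|M. norm (f x * g x))"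
  have amgm: "norm (f x * g x) \<le> (norm (f x))\<^sup>2 + (norm (g x))\<^sup>2" for x
    using sum_squares_bound[of "norm (f x)" "norm (g x)"] 
      mult_nonneg_nonneg[OF norm_ge_zero norm_ge_zero, of "f x" "g x"] unfolding norm_mult by linarith
  show i: "integrable M (\<lambda>x. f x * g x)"
    by (rule Bochner_Integration.integrable_bound[OF Bochner_Integration.integrable_add[OF f(2) g(2)]])
      (simp_all add: amgm)
  \<comment> \<open>The quadratic polynomial whose discriminant gives the Cauchy-Schwarz inequality; it is minimal at \<open>s = P / A\<close>.\<close>
  have P: "2 * s * P \<le> s\<^sup>2 * A + B" for s
  proof -
    have "2 * s * P = (LINT x|M. 2 * s * norm (f x * g x))" by (simp add: P_def)
    also have "\<dots> \<le> (LINT x|M. s\<^sup>2 * (norm (f x))\<^sup>2 + (norm (g x))\<^sup>2)"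
    proof (rule integral_mono)
      fix x
      show "2 * s * norm (f x * g x) \<le> s\<^sup>2 * (norm (f x))\<^sup>2 + (norm (g x))\<^sup>2"
        using sum_squares_bound[of "s * norm (f x)" "norm (g x)"] by (simp add: norm_mult power_mult_distrib)
    qed (use i f(2) g(2) in simp_all)
    also have "\<dots> = s\<^sup>2 * A + B" using f g by (simp add: A_def B_def)
    finally show ?thesis .
  qed
  have nonneg: "0 \<le> A" "0 \<le> B" "0 \<le> P"
    unfolding A_def B_def P_def by (simp_all add: integral_nonneg_AE)
  have "P\<^sup>2 \<le> A * B"
  proof (cases "A = 0")
    case True
    have "P = 0"
    proof (rule ccontr)
      assume "P \<noteq> 0"
      then have "2 * ((B + 1) / P) * P = 2 * (B + 1)" by simp
      then show False using P[of "(B + 1) / P"] nonneg(2) True by simp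
    qed
    then show ?thesis using True by simp
  next
    case False
    then have "2 * (P / A) * P = 2 * (P\<^sup>2 / A)" "(P / A)\<^sup>2 * A = P\<^sup>2 / A"
      by (simp_all add: power2_eq_square)
    then have "P\<^sup>2 / A \<le> B" using P[of "P / A"] by linarith
    then show ?thesis using False nonneg(1) by (simp add: pos_divide_le_eq mult.commute)
  qed
  moreover have "norm (LINT x|M. f x * g x) \<le> P"
    unfolding P_def by (rule integral_norm_bound)
  ultimately show "(norm (LINT x|M. f x * g x))\<^sup>2 \<le> (LINT x|M. (norm (f x))\<^sup>2) * (LINT x|M. (norm (g x))\<^sup>2)"
    unfolding A_def B_def by (meson norm_ge_zero order_trans power_mono)
qed

section \<open>Sections of zonal kernels\<close>

lemma kernel_section_measurable:
  fixes Z :: "'q::finite kernel"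
  assumes "Z \<in> borel_measurable surface_measure2" "norm x = 1"
  shows "(\<lambda>y. Z (x, y)) \<in> borel_measurable surface_measure" "(\<lambda>y. Z (y, x)) \<in> borel_measurable surface_measure"
  using assms by (auto intro!: measurable_compose[OF measurable_Pair1'] measurable_compose[OF measurable_Pair2'])

lemma pair_sigma_finite_surface: "pair_sigma_finite (surface_measure :: (complex ^ 'q::finite) measure) (surface_measure :: (complex ^ 'q) measure)"
  by (intro pair_sigma_finite.intro finite_measure.axioms(1) finite_measure_surface_measure)

lemma kernel_swap:
  fixes Z :: "'q::finite kernel"
  assumes "Z \<in> L2_kernels" 
  shows "(\<lambda>(x, y). Z (y, x)) \<in> L2_kernels"
proof -
  interpret pair_sigma_finite "surface_measure :: (complex ^ 'q) measure" "surface_measure :: (complex ^ 'q) measure"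
    by (rule pair_sigma_finite_surface)
  show ?thesis
    using assms integrable_product_swap[of "\<lambda>p. (norm (Z p))\<^sup>2"] measurable_pair_swap[of Z]
    by (auto simp: L2_kernels_def split_beta')
qed

lemma zonal_swap: "zonal Z \<Longrightarrow> zonal (\<lambda>(x, y). Z (y, x))"
  by (simp add: zonal_def)

lemma zonal_section_householder:
  assumes "zonal Z" "norm x = 1" "norm a = 1" "norm \<xi> = 1"
  shows "Z (x, \<xi>) = Z (a, householder x a \<xi>)"
  using assms unitary_householder[OF assms(2,3)] unfolding zonal_def
  by (metis householder_apply mem_sphere_0)

text \<open>
  Fubini gives square integrability of the sections only almost everywhere. One good section is
  enough, since by zonality any two sections differ by a unitary change of variable.
\<close>

lemma
  fixes Z :: "'q::finite kernel"
  assumes Z: "Z \<in> L2_kernels" "zonal Z" and x: "norm x = 1"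
  shows zonal_section_L2: "integrable surface_measure (\<lambda>\<xi>. (norm (Z (x, \<xi>)))\<^sup>2)"
    and zonal_section_norm_eq: "norm y = 1 \<Longrightarrow>
      (LINT \<xi>|surface_measure. (norm (Z (x, \<xi>)))\<^sup>2) = (LINT \<xi>|surface_measure. (norm (Z (y, \<xi>)))\<^sup>2)"
proof -
  let ?S = "surface_measure :: (complex ^ 'q) measure"
  interpret pair_sigma_finite ?S ?S by (rule pair_sigma_finite_surface)
  have Zm: "Z \<in> borel_measurable surface_measure2" "integrable surface_measure2 (\<lambda>p. (norm (Z p))\<^sup>2)"
    using Z(1) by (auto simp: L2_kernels_def)
  have h: "(integrable ?S (\<lambda>\<xi>. (norm (Z (x, \<xi>)))\<^sup>2) \<longleftrightarrow> integrable ?S (\<lambda>\<xi>. (norm (Z (y, \<xi>)))\<^sup>2)) \<and>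
      (LINT \<xi>|?S. (norm (Z (x, \<xi>)))\<^sup>2) = (LINT \<xi>|?S. (norm (Z (y, \<xi>)))\<^sup>2)"
    if "norm x = 1" "norm y = 1" for x y
  proof -
    have T: "orthogonal_transformation (householder x y)"
      by (intro unitary_op_orthogonal unitary_householder that)
    have m: "(\<lambda>\<xi>. (norm (Z (y, \<xi>)))\<^sup>2) \<in> borel_measurable ?S"
      using kernel_section_measurable(1)[OF Zm(1) that(2)] by measurable
    have "integrable ?S (\<lambda>\<xi>. (norm (Z (x, \<xi>)))\<^sup>2) \<longleftrightarrow> integrable ?S (\<lambda>\<xi>. (norm (Z (y, householder x y \<xi>)))\<^sup>2)"
      by (rule Bochner_Integration.integrable_cong) (simp_all add: zonal_section_householder[OF Z(2) that])
    moreover have "(LINT \<xi>|?S. (norm (Z (x, \<xi>)))\<^sup>2) = (LINT \<xi>|?S. (norm (Z (y, householder x y \<xi>)))\<^sup>2)"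
      by (rule Bochner_Integration.integral_cong) (simp_all add: zonal_section_householder[OF Z(2) that])
    ultimately show ?thesis
      using integral_surface_measure_orthogonal[OF T m] integrable_surface_measure_orthogonal[OF T m] by simp
  qed
  show "norm y = 1 \<Longrightarrow>
      (LINT \<xi>|surface_measure. (norm (Z (x, \<xi>)))\<^sup>2) = (LINT \<xi>|surface_measure. (norm (Z (y, \<xi>)))\<^sup>2)"
    using h[OF x] by simp
  have "AE a in ?S. integrable ?S (\<lambda>\<xi>. (norm (Z (a, \<xi>)))\<^sup>2)"
    using AE_integrable_fst'[OF Zm(2)] by simp
  then have "AE a in ?S. a \<in> space ?S \<and> integrable ?S (\<lambda>\<xi>. (norm (Z (a, \<xi>)))\<^sup>2)"
    using AE_space by eventually_elim simp
  moreover have "ae_filter ?S \<noteq> bot"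
    by (simp add: ae_filter_eq_bot_iff surface_measure_sphere sphere_area_def)
  ultimately have "\<exists>a\<in>space ?S. integrable ?S (\<lambda>\<xi>. (norm (Z (a, \<xi>)))\<^sup>2)"
    using eventually_happens' by blast
  then show "integrable ?S (\<lambda>\<xi>. (norm (Z (x, \<xi>)))\<^sup>2)"
    using h[OF x] by auto
qed

text \<open>
  All sections with first argument near \<open>a\<close> are compared with the one at the antipode \<open>- a\<close>: the
  section at \<open>x\<close> is the section at \<open>- a\<close> composed with the reflection taking \<open>x\<close> to \<open>- a\<close>, which
  depends continuously on \<open>x\<close> near \<open>a\<close>.
\<close>

lemma zonal_section_L2_continuous:
  fixes Z :: "'q::finite kernel"
  assumes Z: "Z \<in> L2_kernels" "zonal Z" and x: "\<And>n. norm (x n) = 1" "norm a = 1" "x \<longlonglongrightarrow> a"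
  shows "(\<lambda>n. LINT \<xi>|surface_measure. (norm (Z (x n, \<xi>) - Z (a, \<xi>)))\<^sup>2) \<longlonglongrightarrow> 0"
proof -
  let ?S = "surface_measure :: (complex ^ 'q) measure"
  let ?H = "\<lambda>x. householder x (- a)"
  have T: "orthogonal_transformation (?H x)" if "norm x = 1" for x
    using x(2) that by (intro unitary_op_orthogonal unitary_householder) auto
  have Zm: "Z \<in> borel_measurable surface_measure2" using Z(1) by (auto simp: L2_kernels_def)
  have "(\<lambda>n. LINT \<xi>|?S. (norm (Z (- a, ?H (x n) \<xi>) - Z (- a, ?H a \<xi>)))\<^sup>2) \<longlonglongrightarrow> 0"
    using x
    by (intro tendsto_L2_orthogonal[where f = "\<lambda>\<xi>. Z (- a, \<xi>)"] T kernel_section_measurable Zm zonal_section_L2 Z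
        tendsto_householder) simp_all
  moreover have "(LINT \<xi>|?S. (norm (Z (- a, ?H (x n) \<xi>) - Z (- a, ?H a \<xi>)))\<^sup>2) =
      (LINT \<xi>|?S. (norm (Z (x n, \<xi>) - Z (a, \<xi>)))\<^sup>2)" for n
    using x
    by (intro Bochner_Integration.integral_cong)
      (simp_all add: zonal_section_householder[OF Z(2) x(1)[of n], of "- a"] zonal_section_householder[OF Z(2) x(2), of "- a"])
  ultimately show ?thesis by simp
qed

section \<open>Continuity of the convolution\<close>

lemma tendsto_integral_mult_L2:
  fixes f g :: "nat \<Rightarrow> 'a \<Rightarrow> complex"
  assumes f: "\<And>n. f n \<in> borel_measurable M" "\<And>n. integrable M (\<lambda>x. (norm (f n x))\<^sup>2)"
    and g: "\<And>n. g n \<in> borel_measurable M" "\<And>n. integrable M (\<lambda>x. (norm (g n x))\<^sup>2)"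
    and f': "f' \<in> borel_measurable M" "integrable M (\<lambda>x. (norm (f' x))\<^sup>2)"
    and g': "g' \<in> borel_measurable M" "integrable M (\<lambda>x. (norm (g' x))\<^sup>2)"
    and B: "\<And>n. (LINT x|M. (norm (g n x))\<^sup>2) \<le> B"
    and limf: "(\<lambda>n. LINT x|M. (norm (f n x - f' x))\<^sup>2) \<longlonglongrightarrow> 0"
    and limg: "(\<lambda>n. LINT x|M. (norm (g n x - g' x))\<^sup>2) \<longlonglongrightarrow> 0"
  shows "(\<lambda>n. LINT x|M. f n x * g n x) \<longlonglongrightarrow> (LINT x|M. f' x * g' x)"
proof -
  have sq: "integrable M (\<lambda>x. (norm (u x - v x))\<^sup>2)"
    if [measurable]: "u \<in> borel_measurable M" "v \<in> borel_measurable M" and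
      i: "integrable M (\<lambda>x. (norm (u x))\<^sup>2)" "integrable M (\<lambda>x. (norm (v x))\<^sup>2)" for u v :: "'a \<Rightarrow> complex"
  proof (rule Bochner_Integration.integrable_bound)
    show "integrable M (\<lambda>x. 2 * (norm (u x))\<^sup>2 + 2 * (norm (v x))\<^sup>2)" using i by simp
    have "(norm (u x - v x))\<^sup>2 \<le> 2 * (norm (u x))\<^sup>2 + 2 * (norm (v x))\<^sup>2" for x
    proof -
      have "(norm (u x - v x))\<^sup>2 \<le> (norm (u x) + norm (v x))\<^sup>2"
        by (intro power_mono norm_triangle_ineq4) simp
      also have "\<dots> \<le> 2 * (norm (u x))\<^sup>2 + 2 * (norm (v x))\<^sup>2"
        using sum_squares_bound[of "norm (u x)" "norm (v x)"] by (simp add: power2_sum)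
      finally show ?thesis .
    qed
    then show "AE x in M. norm ((norm (u x - v x))\<^sup>2) \<le> norm (2 * (norm (u x))\<^sup>2 + 2 * (norm (v x))\<^sup>2)"
      by (intro AE_I2) (simp add: abs_of_nonneg)
  qed measurable
  have m: "(\<lambda>x. f n x - f' x) \<in> borel_measurable M" "(\<lambda>x. g n x - g' x) \<in> borel_measurable M" for n
    using f(1) g(1) f'(1) g'(1) by auto
  note df = sq[OF f(1) f'(1) f(2) f'(2)] and dg = sq[OF g(1) g'(1) g(2) g'(2)]
  have lim1: "(\<lambda>n. LINT x|M. (f n x - f' x) * g n x) \<longlonglongrightarrow> 0"
  proof -
    have "(\<lambda>n. (LINT x|M. (norm (f n x - f' x))\<^sup>2) * B) \<longlonglongrightarrow> 0" using tendsto_mult_right[OF limf, of B] by simp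
    then have "(\<lambda>n. (norm (LINT x|M. (f n x - f' x) * g n x))\<^sup>2) \<longlonglongrightarrow> 0"
    proof (rule tendsto_sandwich[OF always_eventually always_eventually tendsto_const, rotated 2]; intro allI)
      fix n
      show "(norm (LINT x|M. (f n x - f' x) * g n x))\<^sup>2 \<le> (LINT x|M. (norm (f n x - f' x))\<^sup>2) * B"
        using Cauchy_Schwarz_integral(2)[OF m(1) df g]
        by (rule order_trans) (intro mult_left_mono B integral_nonneg_AE, simp)
    qed simp
    then show ?thesis by (simp add: tendsto_norm_zero_iff)
  qed
  have lim2: "(\<lambda>n. LINT x|M. f' x * (g n x - g' x)) \<longlonglongrightarrow> 0"
  proof -
    have "(\<lambda>n. (LINT x|M. (norm (f' x))\<^sup>2) * (LINT x|M. (norm (g n x - g' x))\<^sup>2)) \<longlonglongrightarrow> 0"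
      using tendsto_mult_left[OF limg] by fastforce
    then have "(\<lambda>n. (norm (LINT x|M. f' x * (g n x - g' x)))\<^sup>2) \<longlonglongrightarrow> 0"
    proof (rule tendsto_sandwich[OF always_eventually always_eventually tendsto_const, rotated 2]; intro allI)
      fix n
      show "(norm (LINT x|M. f' x * (g n x - g' x)))\<^sup>2 \<le> (LINT x|M. (norm (f' x))\<^sup>2) * (LINT x|M. (norm (g n x - g' x))\<^sup>2)"
        by (rule Cauchy_Schwarz_integral(2)[OF f' m(2) dg])
    qed simp
    then show ?thesis by (simp add: tendsto_norm_zero_iff)
  qed
  have "(LINT x|M. (f n x - f' x) * g n x) + (LINT x|M. f' x * (g n x - g' x)) + (LINT x|M. f' x * g' x) =
      (LINT x|M. f n x * g n x)" for n
  proof -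
    note i = Cauchy_Schwarz_integral(1)[OF m(1) df g] Cauchy_Schwarz_integral(1)[OF f' m(2) dg]
      Cauchy_Schwarz_integral(1)[OF f' g']
    have "(LINT x|M. (f n x - f' x) * g n x) + (LINT x|M. f' x * (g n x - g' x)) + (LINT x|M. f' x * g' x) =
       (LINT x|M. (f n x - f' x) * g n x + f' x * (g n x - g' x) + f' x * g' x)"
      using i by (simp only: Bochner_Integration.integral_add Bochner_Integration.integrable_add)
    then show ?thesis by (simp add: algebra_simps)
  qed
  then show ?thesis using tendsto_add[OF tendsto_add[OF lim1 lim2] tendsto_const[of "LINT x|M. f' x * g' x"]] by simp
qed

text \<open>
  The convolution at \<open>(x, y)\<close> pairs the section of \<open>Z\<close> with first argument \<open>x\<close> and the section
  with second argument \<open>y\<close>. Both depend continuously on their parameter in L2; the claim for the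
  second argument is the one for the first, applied to the transposed kernel, which is zonal too.
\<close>

lemma continuous_kernel_conv:
  fixes Z :: "'q::finite kernel"
  assumes Z: "Z \<in> L2_kernels" "zonal Z"
  shows "continuous_on (sphere 0 1 \<times> sphere 0 1) (kernel_conv Z Z)"
proof (unfold continuous_on_sequentially, intro ballI allI impI, elim conjE)
  fix p :: "nat \<Rightarrow> (complex ^ 'q) \<times> (complex ^ 'q)" and p'
  assume p: "p' \<in> sphere 0 1 \<times> sphere 0 1" "\<forall>n. p n \<in> sphere 0 1 \<times> sphere 0 1" "p \<longlonglongrightarrow> p'"
  define x y a b where "x n = fst (p n)" and "y n = snd (p n)" and "a = fst p'" and "b = snd p'" for n
  have xy: "norm (x n) = 1" "norm (y n) = 1" "norm a = 1" "norm b = 1" for n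
    using p(1,2) by (auto simp: x_def y_def a_def b_def mem_Times_iff)
  have lim: "x \<longlonglongrightarrow> a" "y \<longlonglongrightarrow> b"
    unfolding x_def[abs_def] y_def[abs_def] a_def b_def by (rule tendsto_fst[OF p(3)], rule tendsto_snd[OF p(3)])
  let ?W = "\<lambda>(x, y). Z (y, x)"
  have W: "?W \<in> L2_kernels" "zonal ?W" using Z by (simp_all add: kernel_swap zonal_swap)
  have Zm: "Z \<in> borel_measurable surface_measure2" using Z(1) by (auto simp: L2_kernels_def)
  have "(\<lambda>n. LINT \<xi>|surface_measure. Z (x n, \<xi>) * Z (\<xi>, y n)) \<longlonglongrightarrow> (LINT \<xi>|surface_measure. Z (a, \<xi>) * Z (\<xi>, b))"
  proof (rule tendsto_integral_mult_L2[where B = "LINT \<xi>|surface_measure. (norm (Z (\<xi>, b)))\<^sup>2"])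
    show "(LINT \<xi>|surface_measure. (norm (Z (\<xi>, y n)))\<^sup>2) \<le> (LINT \<xi>|surface_measure. (norm (Z (\<xi>, b)))\<^sup>2)" for n
      using zonal_section_norm_eq[OF W xy(2)[of n] xy(4)] by simp
    show "(\<lambda>n. LINT \<xi>|surface_measure. (norm (Z (\<xi>, y n) - Z (\<xi>, b)))\<^sup>2) \<longlonglongrightarrow> 0"
      using zonal_section_L2_continuous[OF W xy(2,4) lim(2)] by simp
    show "integrable surface_measure (\<lambda>\<xi>. (norm (Z (\<xi>, y n)))\<^sup>2)" for n
      using zonal_section_L2[OF W xy(2)[of n]] by simp
    show "integrable surface_measure (\<lambda>\<xi>. (norm (Z (\<xi>, b)))\<^sup>2)"
      using zonal_section_L2[OF W xy(4)] by simp
  qed (intro kernel_section_measurable Zm xy lim zonal_section_L2 zonal_section_L2_continuous Z)+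
  then have "(\<lambda>n. kernel_conv Z Z (x n, y n)) \<longlonglongrightarrow> kernel_conv Z Z (a, b)"
    unfolding kernel_conv_def case_prod_conv by (intro tendsto_mult tendsto_const)
  then show "(kernel_conv Z Z \<circ> p) \<longlonglongrightarrow> kernel_conv Z Z p'"
    by (simp add: x_def y_def a_def b_def o_def)
qed

lemma AE_pair_fst:
  assumes "sigma_finite_measure N" "AE x in M. P x"
  shows "AE p in M \<Otimes>\<^sub>M N. P (fst p)"
proof -
  interpret N: sigma_finite_measure N by fact
  from assms(2) obtain A where A: "{x \<in> space M. \<not> P x} \<subseteq> A" "emeasure M A = 0" "A \<in> sets M"
    by (auto elim: AE_E)
  show ?thesis
  proof (rule AE_I)
    show "A \<times> space N \<in> sets (M \<Otimes>\<^sub>M N)" using A by auto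
    show "emeasure (M \<Otimes>\<^sub>M N) (A \<times> space N) = 0"
      using A by (simp add: N.emeasure_pair_measure_Times)
  qed (use A in \<open>auto simp: space_pair_measure\<close>)
qed

lemma AE_pair_snd:
  assumes "sigma_finite_measure N" "AE y in N. P y"
  shows "AE p in M \<Otimes>\<^sub>M N. P (snd p)"
proof -
  interpret N: sigma_finite_measure N by fact
  from assms(2) obtain A where A: "{x \<in> space N. \<not> P x} \<subseteq> A" "emeasure N A = 0" "A \<in> sets N"
    by (auto elim: AE_E)
  show ?thesis
  proof (rule AE_I)
    show "space M \<times> A \<in> sets (M \<Otimes>\<^sub>M N)" using A by auto
    show "emeasure (M \<Otimes>\<^sub>M N) (space M \<times> A) = 0"
      using A by (simp add: N.emeasure_pair_measure_Times)
  qed (use A in \<open>auto simp: space_pair_measure\<close>)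
qed

text \<open>
  The convolution depends on the values of the kernels on single slices, which are null sets; but by
  Fubini almost every horizontal slice and almost every vertical slice meets the exceptional set in a null
  set, and \<open>(x, y)\<close> involves just one slice of each kind.
\<close>

lemma kernel_conv_cong_AE:
  fixes J Z :: "'q::finite kernel"
  assumes m: "J \<in> borel_measurable surface_measure2" "Z \<in> borel_measurable surface_measure2"
    and eq: "AE p in surface_measure2. J p = Z p"
  shows "AE p in surface_measure2. kernel_conv J J p = kernel_conv Z Z p"
proof -
  let ?S = "surface_measure :: (complex ^ 'q) measure"
  interpret pair_sigma_finite ?S ?S by (rule pair_sigma_finite_surface)
  have 1: "AE x in ?S. AE \<xi> in ?S. J (x, \<xi>) = Z (x, \<xi>)" using eq by (rule AE_pair)
  have "AE y in ?S. AE \<xi> in ?S. J (\<xi>, y) = Z (\<xi>, y)"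
  proof (rule AE_commute[THEN iffD1, OF _ 1])
    show "{p \<in> space surface_measure2. J (fst p, snd p) = Z (fst p, snd p)} \<in> sets surface_measure2"
      unfolding prod.collapse using m[measurable] by measurable
  qed
  then have "AE p in surface_measure2. AE \<xi> in ?S. J (\<xi>, snd p) = Z (\<xi>, snd p)"
    by (rule AE_pair_snd[OF M1.sigma_finite_measure_axioms])
  moreover have "AE p in surface_measure2. AE \<xi> in ?S. J (fst p, \<xi>) = Z (fst p, \<xi>)"
    using 1 by (rule AE_pair_fst[OF M1.sigma_finite_measure_axioms])
  ultimately show ?thesis using AE_space
  proof eventually_elim
    case (elim p)
    then obtain x y where p: "p = (x, y)" "norm x = 1" "norm y = 1" by (auto simp: space_pair_measure)
    note [measurable] = kernel_section_measurable[OF m(1) p(2)] kernel_section_measurable[OF m(1) p(3)]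
       kernel_section_measurable[OF m(2) p(2)] kernel_section_measurable[OF m(2) p(3)]
    have "(LINT \<xi>|?S. J (x, \<xi>) * J (\<xi>, y)) = (LINT \<xi>|?S. Z (x, \<xi>) * Z (\<xi>, y))"
      using elim p by (intro integral_cong_AE) auto
    then show ?case by (simp add: kernel_conv_def p)
  qed
qed

theorem proposition3p7:
  fixes K :: "'q::finite kernel"
  assumes "K \<in> L2_kernels"
    and "\<exists>J\<in>zonal_L2_kernels. AE p in surface_measure2. K p = kernel_conv J J p"
  shows "\<exists>C. continuous_on (sphere 0 1 \<times> sphere 0 1) C \<and> (AE p in surface_measure2. K p = C p)"
proof -
  obtain J Z where J: "J \<in> L2_kernels" "AE p in surface_measure2. K p = kernel_conv J J p"
      and Z: "Z \<in> L2_kernels" "zonal Z" "AE p in surface_measure2. J p = Z p"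
    using assms(2) by (auto simp: zonal_L2_kernels_def)
  have "AE p in surface_measure2. kernel_conv J J p = kernel_conv Z Z p"
    using J(1) Z by (intro kernel_conv_cong_AE) (simp_all add: L2_kernels_def)
  with J(2) have "AE p in surface_measure2. K p = kernel_conv Z Z p"
    by eventually_elim simp
  then show ?thesis
    using continuous_kernel_conv[OF Z(1,2)] by blast
qed

end
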